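(* If $\alpha\in(0,1)\setminus\mathbb{Q}$ is a root of a quadratic equation with integer coefficients, then $$\lim_{N\to\infty} \frac{\#\{1\le n\le N : \#\Delta_n(\alpha)=2\}}{N} = 0.$$
   Context: For $x\in\mathbb{R}$, $\langle x\rangle = x \bmod 1$ denotes the fractional part. For $\alpha\in(0,1)\setminus\mathbb{Q}$ and $n\in\mathbb{N}$, let $P_n(\alpha)=\{\langle 0\alpha\rangle,\langle 1\alpha\rangle,\dots,\langle (n-1)\alpha\rangle, 1\}\subset[0,1]$. Arranging these points in increasing order, the lengths of the gaps between consecutive points form the set $\Delta_n(\alpha)$ of gap lengths, and $\#\Delta_n(\alpha)$ denotes the number of distinct gap lengths (so repeated lengths are counted once). *)

theory Defs
  imports "HOL-Analysis.Analysis"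
begin

definition rot_points :: "real \<Rightarrow> nat \<Rightarrow> real set" where
  "rot_points \<alpha> n = (\<lambda>i. frac (real i * \<alpha>)) ` {..<n} \<union> {1}"

definition gap_lengths :: "real \<Rightarrow> nat \<Rightarrow> real set" where
  "gap_lengths \<alpha> n =
     {y - x | x y. x \<in> rot_points \<alpha> n \<and> y \<in> rot_points \<alpha> n \<and> x < y \<and>
                   (\<forall>z \<in> rot_points \<alpha> n. \<not> (x < z \<and> z < y))}"

end

theory Submission
  imports Defs
begin

text \<open>
  Identify the point 1 with 0 and view the points on the circle. Let \<open>s\<close> and \<open>t\<close> be the indices
  in \<open>{1..<n}\<close> of the right and left neighbours of 0, at distances \<open>a\<close> and \<open>b\<close>. Both \<open>a\<close> and \<open>b\<close>
  are gap lengths, and \<open>a \<noteq> b\<close>. If \<open>s + t > n\<close>, then the points of index \<open>t - 1\<close> and \<open>s - 1\<close> are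
  consecutive, so that \<open>a + b\<close> is a third length; and \<open>s + t < n\<close> is impossible, as the point
  of index \<open>s + t\<close> would lie between the two neighbours of 0. Hence two lengths force
  \<open>n = s + t\<close>. When \<open>n\<close> grows from one such value to the next, \<open>s\<close> or \<open>t\<close> is replaced by an index
  that is at least the old \<open>n\<close>, so the increment is at least \<open>min s t\<close>. This minimum tends to
  infinity because the orbit accumulates at 0 from both sides, so the set of such \<open>n\<close> has
  density zero.
\<close>

section \<open>Closest returns of the orbit to 0\<close>

text \<open>The sign of \<open>\<beta>\<close> selects the side: \<open>\<alpha>\<close> yields the
  right neighbour of 0 and \<open>-\<alpha>\<close> the left one. Index 0 is excluded because it
  gives the point 0 itself.\<close>

definition closest_return :: "real \<Rightarrow> nat \<Rightarrow> nat \<Rightarrow> bool" where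
  "closest_return \<beta> n i \<longleftrightarrow>
     i \<in> {1..<n} \<and> (\<forall>j\<in>{1..<n}. frac (real i * \<beta>) \<le> frac (real j * \<beta>))"

lemma irrational_mult_notin_Ints:
  fixes \<beta> :: real
  assumes "\<beta> \<notin> \<rat>" "k \<noteq> 0"
  shows "of_int k * \<beta> \<notin> \<int>"
proof
  assume "of_int k * \<beta> \<in> \<int>"
  then have "of_int k * \<beta> / of_int k \<in> \<rat>"
    by (intro Rats_divide) (use Ints_subset_Rats in auto)
  with assms show False by simp
qed

lemma irrational_nat_mult_notin_Ints:
  fixes \<beta> :: real
  assumes "\<beta> \<notin> \<rat>" "k > 0"
  shows "real k * \<beta> \<notin> \<int>"
  using irrational_mult_notin_Ints[OF assms(1), of "int k"] assms(2) by simp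

lemma frac_mult_inj:
  fixes \<beta> :: real
  assumes "\<beta> \<notin> \<rat>" "frac (real i * \<beta>) = frac (real j * \<beta>)"
  shows "i = j"
proof (rule ccontr)
  assume "i \<noteq> j"
  have "real i * \<beta> - real j * \<beta> \<in> \<int>"
    using frac_diff_eq[OF assms(2)] by simp
  then have "of_int (int i - int j) * \<beta> \<in> \<int>"
    by (simp add: algebra_simps)
  with irrational_mult_notin_Ints[OF assms(1), of "int i - int j"] \<open>i \<noteq> j\<close> show False
    by simp
qed

lemma closest_return_exists:
  assumes "n \<ge> 2"
  obtains i where "closest_return \<beta> n i"
proof -
  have "finite {1..<n}" "{1..<n} \<noteq> {}" using assms by auto
  from ex_min_if_finite[of "(\<lambda>i. frac (real i * \<beta>)) ` {1..<n}"] this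
  obtain i where "i \<in> {1..<n}" "\<forall>j\<in>{1..<n}. \<not> frac (real j * \<beta>) < frac (real i * \<beta>)"
    by auto
  then show thesis
    by (intro that[of i]) (auto simp: closest_return_def not_less)
qed

lemma closest_return_le:
  assumes "closest_return \<beta> n i" "1 \<le> k" "k < n" "real k * \<beta> - p \<in> \<int>" "0 \<le> p" "p < 1"
  shows "frac (real i * \<beta>) \<le> p"
proof -
  have "frac (real k * \<beta>) = p" using assms by (simp add: frac_unique_iff)
  with assms show ?thesis by (auto simp: closest_return_def)
qed

lemma closest_return_unique:
  assumes "\<beta> \<notin> \<rat>" "closest_return \<beta> n i" "closest_return \<beta> n j"
  shows "i = j"
proof -
  have "frac (real i * \<beta>) = frac (real j * \<beta>)"
    using assms unfolding closest_return_def by (meson order_antisym)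
  with assms(1) show ?thesis by (rule frac_mult_inj)
qed

text \<open>If \<open>j < n\<close>, then \<open>j\<close> also minimises over the shorter range,
  and the minimiser is unique by irrationality.\<close>

lemma closest_return_later:
  assumes "\<beta> \<notin> \<rat>" "closest_return \<beta> n i" "closest_return \<beta> m j" "n \<le> m"
  shows "j = i \<or> n \<le> j"
proof (rule ccontr)
  assume "\<not> (j = i \<or> n \<le> j)"
  then have "closest_return \<beta> n j"
    using assms(3,4) by (auto simp: closest_return_def)
  with closest_return_unique[OF assms(1,2)] \<open>\<not> (j = i \<or> n \<le> j)\<close> show False by simp
qed

text \<open>The finitely many indices below \<open>L\<close> keep a positive distance from 0, and by
  Kronecker's theorem some later index comes closer.\<close>

lemma closest_return_unbounded:
  assumes "\<beta> \<notin> \<rat>"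
  obtains M where "\<And>n i. M \<le> n \<Longrightarrow> closest_return \<beta> n i \<Longrightarrow> L \<le> i"
proof -
  \<comment> \<open>The extra element 1 keeps the set nonempty when
    \<open>L \<le> 1\<close>.\<close>
  define c where "c = Min (insert 1 ((\<lambda>i. frac (real i * \<beta>)) ` {1..<L}))"
  have "c > 0"
    unfolding c_def using irrational_nat_mult_notin_Ints[OF assms]
    by (subst Min_gr_iff) auto
  then obtain k where k: "k > 0" "\<bar>frac (real k * \<beta>) - 0\<bar> < c"
    using Kronecker_approx_1_explicit[OF assms, of 0 c] by auto
  have "L \<le> i" if "Suc k \<le> n" "closest_return \<beta> n i" for n i
  proof (rule ccontr)
    assume "\<not> L \<le> i"
    then have "c \<le> frac (real i * \<beta>)"
      unfolding c_def using that by (intro Min_le) (auto simp: closest_return_def)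
    moreover have "frac (real i * \<beta>) \<le> frac (real k * \<beta>)"
      using that k by (auto simp: closest_return_def)
    ultimately show False using k by simp
  qed
  then show thesis by (rule that)
qed

section \<open>Values of n with exactly two gap lengths\<close>

lemma two_gap_lengths_imp:
  fixes \<alpha> :: real
  assumes \<alpha>: "0 < \<alpha>" "\<alpha> < 1" "\<alpha> \<notin> \<rat>"
    and s: "closest_return \<alpha> n s" and t: "closest_return (-\<alpha>) n t"
    and two: "card (gap_lengths \<alpha> n) = 2"
  shows "n = s + t"
proof (rule ccontr)
  assume ne: "n \<noteq> s + t"
  define a where "a = frac (real s * \<alpha>)"
  define b where "b = frac (real t * (-\<alpha>))"
  have st: "1 \<le> s" "s < n" "1 \<le> t" "t < n"
    using s t by (auto simp: closest_return_def)
  \<comment> \<open>Positions are recorded modulo 1: index \<open>s\<close> sits at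
    \<open>a\<close>, index \<open>t\<close> at \<open>-b\<close>.\<close>
  have sa: "real s * \<alpha> - a \<in> \<int>" and tb: "real t * \<alpha> + b \<in> \<int>"
    using minus_in_Ints_iff[of "real t * \<alpha> + b"]
    by (auto simp: a_def b_def frac_def algebra_simps)
  have irr: "real k * \<alpha> \<notin> \<int>" if "k > 0" for k
    using irrational_nat_mult_notin_Ints[OF \<alpha>(3) that] .
  have fb: "frac (real t * \<alpha>) = 1 - b"
    using frac_neg[of "real t * \<alpha>"] irr[of t] st by (simp add: b_def)
  have a01: "0 < a" "a < 1" and b01: "0 < b" "b < 1"
    using irr[of s] irr[of t] st by (simp_all add: a_def b_def frac_lt_1)
  have right: "a \<le> p" if "1 \<le> k" "k < n" "real k * \<alpha> - p \<in> \<int>" "0 \<le> p" "p < 1" for k p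
    using closest_return_le[OF s] that unfolding a_def by blast
  have left: "b \<le> p" if "1 \<le> k" "k < n" "real k * \<alpha> + p \<in> \<int>" "0 \<le> p" "p < 1" for k p
  proof -
    have "real k * (-\<alpha>) - p \<in> \<int>"
      using Ints_minus[OF that(3)] by simp
    then show ?thesis using closest_return_le[OF t] that unfolding b_def by blast
  qed
  \<comment> \<open>Comparison with index 1. The two bounds give \<open>a + b \<le> 1\<close>, which
    keeps the representatives below inside the unit interval.\<close>
  have a\<alpha>: "a \<le> \<alpha>" using right[of 1 \<alpha>] \<alpha> st by simp
  have b\<alpha>: "b \<le> 1 - \<alpha>" using left[of 1 "1 - \<alpha>"] \<alpha> st by simp
  have sum: "real (s + t) * \<alpha> - (a - b) \<in> \<int>"
    using Ints_add[OF sa tb] by (simp add: algebra_simps)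
  have ab: "a \<noteq> b"
    using sum irr[of "s + t"] st by auto
  have no_gap: False if "1 \<le> k" "k < n" "real k * \<alpha> - p \<in> \<int>" "-b < p" "p < a" for k p
  proof (cases "p \<ge> 0")
    case True
    then show False using right[of k p] that a01 by simp
  next
    case False
    then show False using left[of k "-p"] that b01 by simp
  qed
  have gt: "n < s + t"
  proof (rule ccontr)
    assume "\<not> n < s + t"
    with ne have "s + t < n" by simp
    with no_gap[OF _ this sum] a01 b01 st show False by simp
  qed
  \<comment> \<open>The empty arc around 0 also avoids index \<open>n\<close>: shifting back by
    \<open>t\<close> and by \<open>s\<close> gives admissible indices, whose distances to 0 force
    \<open>p = a - b\<close>. This is the position of index \<open>s + t\<close>, so irrationality
    would give \<open>n = s + t\<close>.\<close>
  have no_gap_n: False if p: "real n * \<alpha> - p \<in> \<int>" "-b < p" "p < a" for p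
  proof -
    have "real (n - t) * \<alpha> - (p + b) \<in> \<int>"
      using Ints_diff[OF p(1) tb] st by (simp add: algebra_simps of_nat_diff)
    then have "a \<le> p + b"
      using right[of "n - t" "p + b"] p st a\<alpha> b\<alpha> by simp
    moreover have "real (n - s) * \<alpha> + (a - p) \<in> \<int>"
      using Ints_diff[OF p(1) sa] st by (simp add: algebra_simps of_nat_diff)
    then have "b \<le> a - p"
      using left[of "n - s" "a - p"] p st a\<alpha> b\<alpha> by simp
    ultimately have "p = a - b" by simp
    with Ints_diff[OF sum p(1)] have "real (s + t - n) * \<alpha> \<in> \<int>"
      using gt by (simp add: algebra_simps of_nat_diff)
    with irr[of "s + t - n"] gt show False by simp
  qed
  have in_pts: "x \<in> rot_points \<alpha> n"
    if "k < n" "real k * \<alpha> - x \<in> \<int>" "0 \<le> x" "x < 1" for k x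
    using that frac_unique_iff[of "real k * \<alpha>" x] by (force simp: rot_points_def)
  have pts_cases: "(z = 1) \<or> (\<exists>k<n. real k * \<alpha> - z \<in> \<int> \<and> 0 \<le> z \<and> z < 1)"
    if "z \<in> rot_points \<alpha> n" for z
    using that frac_unique_iff[of _ z] by (auto simp: rot_points_def)
  have "a \<in> gap_lengths \<alpha> n"
  proof -
    have "0 \<in> rot_points \<alpha> n" "a \<in> rot_points \<alpha> n"
      using in_pts[of 0 0] in_pts[of s a] sa st a01 by auto
    moreover have "\<not> (0 < z \<and> z < a)" if "z \<in> rot_points \<alpha> n" for z
    proof
      assume z: "0 < z \<and> z < a"
      with pts_cases[OF that] a01 obtain k where k: "k < n" "real k * \<alpha> - z \<in> \<int>" by auto
      show False
      proof (cases "k = 0")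
        case True
        with k z a01 Ints_nonzero_abs_ge1[of "-z"] show False by simp
      next
        case False
        with no_gap[of k z] k z b01 show False by simp
      qed
    qed
    ultimately have "a - 0 \<in> gap_lengths \<alpha> n"
      unfolding gap_lengths_def using a01(1) by blast
    then show ?thesis by simp
  qed
  moreover have "b \<in> gap_lengths \<alpha> n"
  proof -
    have "1 - b \<in> rot_points \<alpha> n" "1 \<in> rot_points \<alpha> n"
      using fb[symmetric] st by (auto simp: rot_points_def)
    moreover have "\<not> (1 - b < z \<and> z < 1)" if "z \<in> rot_points \<alpha> n" for z
    proof
      assume z: "1 - b < z \<and> z < 1"
      with pts_cases[OF that] obtain k where k: "k < n" "real k * \<alpha> - z \<in> \<int>" by auto
      show False
      proof (cases "k = 0")
        case True
        with k z b01 Ints_nonzero_abs_ge1[of "-z"] show False by simp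
      next
        case False
        \<comment> \<open>Subtracting 1 moves the arc to the left of 1 to the left of 0.\<close>
        have "real k * \<alpha> - (z - 1) \<in> \<int>" using Ints_add[OF k(2) Ints_1] by (simp add: algebra_simps)
        with False no_gap[of k "z - 1"] k z a01 show False by simp
      qed
    qed
    ultimately have "1 - (1 - b) \<in> gap_lengths \<alpha> n"
      unfolding gap_lengths_def using b01(1) by (intro CollectI exI[of _ "1 - b"] exI[of _ 1]) auto
    then show ?thesis by simp
  qed
  moreover have "a + b \<in> gap_lengths \<alpha> n"
  proof -
    \<comment> \<open>The arc from \<open>-b\<close> to \<open>a\<close> rotated back by
      \<open>\<alpha>\<close>. Its ends have indices \<open>t - 1\<close> and \<open>s - 1\<close>,
      and its interior no longer contains 0.\<close>
    define x where "x = 1 - b - \<alpha>"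
    define y where "y = 1 + a - \<alpha>"
    have "x \<in> rot_points \<alpha> n"
    proof (rule in_pts)
      show "real (t - 1) * \<alpha> - x \<in> \<int>"
        using Ints_diff[OF tb Ints_1] st by (simp add: x_def algebra_simps of_nat_diff)
    qed (use st b\<alpha> b01 \<alpha> in \<open>auto simp: x_def\<close>)
    moreover have "y \<in> rot_points \<alpha> n"
    \<comment> \<open>In this case \<open>y = 1\<close>, which is a point of the set but not a
      fractional part.\<close>
    proof (cases "a = \<alpha>")
      case True
      then show ?thesis by (simp add: y_def rot_points_def)
    next
      case False
      show ?thesis
      proof (rule in_pts)
        show "real (s - 1) * \<alpha> - y \<in> \<int>"
          using Ints_diff[OF sa Ints_1] st by (simp add: y_def algebra_simps of_nat_diff)
      qed (use st a\<alpha> a01 \<alpha> False in \<open>auto simp: y_def\<close>)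
    qed
    moreover have "\<not> (x < z \<and> z < y)" if "z \<in> rot_points \<alpha> n" for z
    proof
      assume z: "x < z \<and> z < y"
      with pts_cases[OF that] a\<alpha> obtain k where k: "k < n" "real k * \<alpha> - z \<in> \<int>"
        by (auto simp: y_def)
      \<comment> \<open>Rotating forward by \<open>\<alpha>\<close> raises the index to
        \<open>Suc k\<close>, which can equal \<open>n\<close>; hence the separate fact
        \<open>no_gap_n\<close>.\<close>
      define p where "p = z + \<alpha> - 1"
      have p: "real (Suc k) * \<alpha> - p \<in> \<int>" "-b < p" "p < a"
        using Ints_add[OF k(2) Ints_1] z by (auto simp: p_def x_def y_def algebra_simps)
      show False
      proof (cases "Suc k = n")
        case True
        with no_gap_n p show False by simp
      next
        case False
        with no_gap[of "Suc k" p] p k show False by simp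
      qed
    qed
    moreover have "x < y" using a01 b01 by (simp add: x_def y_def)
    ultimately have "y - x \<in> gap_lengths \<alpha> n" unfolding gap_lengths_def by blast
    then show ?thesis by (simp add: x_def y_def algebra_simps)
  qed
  ultimately have "{a, b, a + b} \<subseteq> gap_lengths \<alpha> n" by simp
  \<comment> \<open>An infinite set would have cardinality 0.\<close>
  moreover have "finite (gap_lengths \<alpha> n)" using two by (simp add: card_ge_0_finite)
  ultimately have "card {a, b, a + b} \<le> 2" using two card_mono by metis
  with ab a01 b01 show False by simp
qed

section \<open>Density zero from growing increments\<close>

text \<open>Beyond \<open>M\<close>, each block of \<open>L\<close> consecutive integers contains at
  most one solution, so the upper density is at most \<open>1 / L\<close> for every positive
  \<open>L\<close>.\<close>

lemma density_zero_if_separated: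
  fixes P :: "nat \<Rightarrow> bool"
  assumes "\<And>L. \<exists>M. \<forall>m n. M \<le> m \<longrightarrow> m < n \<longrightarrow> P m \<longrightarrow> P n \<longrightarrow> m + L \<le> n"
  shows "(\<lambda>N. real (card {n \<in> {1..N}. P n}) / real N) \<longlonglongrightarrow> 0"
proof (rule LIMSEQ_I)
  fix r :: real
  assume "r > 0"
  \<comment> \<open>The error is split in halves: this \<open>L\<close> bounds the number of blocks
    by \<open>r * N / 2\<close> up to a constant, and \<open>N0\<close> below absorbs
    \<open>M + 1\<close> in the other half.\<close>
  define L where "L = nat \<lceil>2 / r\<rceil> + 1"
  have L: "L > 0" "2 / r < real L"
    unfolding L_def using \<open>r > 0\<close> by (simp, linarith)
  obtain M where M: "\<And>m n. M \<le> m \<Longrightarrow> m < n \<Longrightarrow> P m \<Longrightarrow> P n \<Longrightarrow> m + L \<le> n"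
    using assms by meson
  have count: "card {n \<in> {1..N}. P n} \<le> M + (N div L + 1)" for N
  proof -
    let ?B = "{n \<in> {M..N}. P n}"
    have "inj_on (\<lambda>n. n div L) ?B"
    proof (rule linorder_inj_onI)
      fix m n assume mn: "m < n" "m \<in> ?B" "n \<in> ?B"
      then have "m + L \<le> n" using M by simp
      then have "(m + L) div L \<le> n div L" by (rule div_le_mono)
      then show "m div L \<noteq> n div L" using L by simp
    qed auto
    then have "card ?B \<le> card {..N div L}"
      by (rule card_inj_on_le) (auto intro: div_le_mono)
    moreover have "card {n \<in> {1..N}. P n} \<le> card ({..<M} \<union> ?B)"
      by (rule card_mono) auto
    moreover have "card ({..<M} \<union> ?B) \<le> card {..<M} + card ?B" by (rule card_Un_le)
    ultimately show ?thesis by simp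
  qed
  define N0 where "N0 = nat \<lceil>2 * real (M + 1) / r\<rceil> + 1"
  have "norm (real (card {n \<in> {1..N}. P n}) / real N - 0) < r" if "N \<ge> N0" for N
  proof -
    have "2 * real (M + 1) / r < real N"
      using that unfolding N0_def by linarith
    then have N: "real (M + 1) < r * real N / 2" "N > 0"
      using \<open>r > 0\<close> that by (auto simp: field_simps N0_def)
    have "real (N div L) \<le> real N / real L" by (simp add: of_nat_div_le_of_nat)
    also have "\<dots> \<le> r * real N / 2"
    proof -
      have "2 \<le> r * real L" using L \<open>r > 0\<close> by (simp add: field_simps)
      then have "real N * 2 \<le> real N * (r * real L)" by (intro mult_left_mono) auto
      then show ?thesis using L by (simp add: field_simps)
    qed
    finally have "real (N div L) \<le> r * real N / 2" .
    moreover have "real (card {n \<in> {1..N}. P n}) \<le> real (M + 1) + real (N div L)"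
      using count[of N] by linarith
    ultimately have "real (card {n \<in> {1..N}. P n}) < r * real N" using N by linarith
    then show ?thesis using N by (simp add: field_simps)
  qed
  then show "\<exists>N0. \<forall>N\<ge>N0. norm (real (card {n \<in> {1..N}. P n}) / real N - 0) < r" by blast
qed

theorem theorem8:
  fixes \<alpha> :: real
  assumes "0 < \<alpha>" and "\<alpha> < 1" and "\<alpha> \<notin> \<rat>"
    and "\<exists>a b c :: int. a \<noteq> 0 \<and> of_int a * \<alpha>\<^sup>2 + of_int b * \<alpha> + of_int c = 0"
  shows "(\<lambda>N. real (card {n \<in> {1..N}. card (gap_lengths \<alpha> n) = 2}) / real N)
           \<longlonglongrightarrow> 0"
proof (rule density_zero_if_separated)
  fix L
  have irr: "-\<alpha> \<notin> \<rat>" using assms(3) by simp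
  obtain M1 where M1: "\<And>n i. M1 \<le> n \<Longrightarrow> closest_return \<alpha> n i \<Longrightarrow> L \<le> i"
    using closest_return_unbounded[OF assms(3)] by blast
  obtain M2 where M2: "\<And>n i. M2 \<le> n \<Longrightarrow> closest_return (-\<alpha>) n i \<Longrightarrow> L \<le> i"
    using closest_return_unbounded[OF irr] by blast
  \<comment> \<open>The summand 2 ensures that both neighbours of 0 exist.\<close>
  have "m + L \<le> n"
    if mn: "M1 + M2 + 2 \<le> m" "m < n"
      and two: "card (gap_lengths \<alpha> m) = 2" "card (gap_lengths \<alpha> n) = 2" for m n
  proof -
    obtain s t s' t'
      where r: "closest_return \<alpha> m s" "closest_return (-\<alpha>) m t"
        "closest_return \<alpha> n s'" "closest_return (-\<alpha>) n t'"
      using closest_return_exists[of m] closest_return_exists[of n] mn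
      by (metis add_leD2 less_imp_le order.trans)
    have eq: "m = s + t" "n = s' + t'"
      using two_gap_lengths_imp[OF assms(1-3)] r two by blast+
    have "s' = s \<or> m \<le> s'" "t' = t \<or> m \<le> t'"
      using closest_return_later[OF assms(3) r(1,3)] closest_return_later[OF irr r(2,4)] mn(2)
      by simp_all
    moreover have "L \<le> s" "L \<le> t" "L \<le> s'" "L \<le> t'"
      using M1[OF _ r(1)] M2[OF _ r(2)] M1[OF _ r(3)] M2[OF _ r(4)] mn by simp_all
    \<comment> \<open>Since \<open>m < n\<close>, the two indices cannot both be unchanged. A
      changed one is at least \<open>m\<close> and the other at least \<open>L\<close>.\<close>
    ultimately show ?thesis using eq mn(2) by auto
  qed
  then show "\<exists>M. \<forall>m n. M \<le> m \<longrightarrow> m < n \<longrightarrow> card (gap_lengths \<alpha> m) = 2 \<longrightarrow>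
      card (gap_lengths \<alpha> n) = 2 \<longrightarrow> m + L \<le> n"
    by blast
qed

end
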